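(* Let $X$ be a simplicial complex with $\Omega=|X|\subset\mathbb R^n$ and $I=[0,1]$, and suppose $\Omega$ is Lipschitz contractible to $a\in\Omega$, with Lipschitz contraction $\Phi:\Omega\times I\to\Omega$. Let $K$ be an admissible product complex of $\Omega\times I$ and $E:C_k(X)\to C_{k+1}(K)$, $k\ge0$, linear maps with $\partial E+E\partial=(j_1)_\#-(j_0)_\#$. Define $\mathrm{Co}^S:C_k(X)\to S_{k+1}^{\mathrm{Lip}}(\Omega)$, $k\ge 0$, by $\mathrm{Co}^S(\sigma)=(\Phi^\#\circ L\circ E)(\sigma)$ for $\sigma\in X^k$, extended linearly. Then $\mathrm{Co}^S$ is a singular cone operator with contraction point $a$; that is, $$\mathrm{Co}^S(\partial_k\sigma)+\partial^S_{k+1}\mathrm{Co}^S(\sigma)=L\sigma\quad\text{for all }\sigma\in X^k,\ k\ge1,$$ $$\partial_1^S\mathrm{Co}^S(v)=L[v]-L[a]\quad\text{for all }v\in X^0.$$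
   Context: $\Omega$ is Lipschitz contractible to $a\in\Omega$ if there is a Lipschitz map $\Phi:\Omega\times I\to\Omega$ (a Lipschitz contraction) with $\Phi(x,1)=x$ and $\Phi(x,0)=a$ for all $x$. $X^k$ is the set of $k$-simplices of $X$; $C_k(\cdot)$ denotes real simplicial $k$-chains and $\partial=\partial_k$ the simplicial boundary map ($\partial=0$ on $0$-chains). A simplicial map $f$ induces $f_\#$ on chains by $f_\#[v_0,\dots,v_k]=[f(v_0),\dots,f(v_k)]$ if the $f(v_i)$ are distinct and $0$ otherwise. A simplicial complex $K$ is an admissible product complex of $\Omega\times I$ if (1) $|K|=\Omega\times I$; (2) for every simplex $\sigma\in X$, $\sigma\times I$ is the underlying space of a subcomplex of $K$; (3) for every $\sigma\in X$, $\sigma\times\{0\}$ and $\sigma\times\{1\}$ are simplices of $K$. The simplicial maps $j_0,j_1:X\to K$ are induced by $v\mapsto(v,0)$ and $v\mapsto(v,1)$ on vertices. $Q_k$ is the standard simplex with vertices $q_0=0$, $q_i=e_i$ ($1\le i\le k$). A Lipschitz singular $k$-simplex of $M$ is a Lipschitz map $T:Q_k\to M$; $S_k^{\mathrm{Lip}}(M)$ is the real vector space of finite formal linear combinations of these, with boundary $\partial_k^S T=\sum_{i=0}^k(-1)^i\,T\circ L[q_0,\dots,\widehat{q_i},\dots,q_k]$, where $L[a_0,\dots,a_k](x)=a_0+\sum_{i=1}^kx_i(a_i-a_0)$. For a Lipschitz map $f:M\to N$, $f^\#:S_k^{\mathrm{Lip}}(M)\to S_k^{\mathrm{Lip}}(N)$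 is the linear map with $f^\#(T)=f\circ T$. Total orders are fixed on the vertices of $X$ and of $K$ such that $j_0$ and $j_1$ are order preserving; simplices are written with increasing vertices and these form the bases of the chain spaces. For an increasing simplex $\sigma=[v_0,\dots,v_k]$ of $X$ or $K$, $L\sigma=L[v_0,\dots,v_k]$, and $L$ is extended linearly to chains of $X$ and of $K$.
   Formalization: For k≥1 the identity is proved with right-hand side Lσ − L[a,…,a] (k+1 entries) instead of Lσ: the constant simplex L[a,…,a] is nonzero in S_k^Lip(Ω), so the displayed identity fails as stated and holds only modulo constant simplices. *)

theory Defs
  imports "HOL-Analysis.Analysis" "HOL-Analysis.Finite_Function_Topology"
begin

text \<open>Real chains are finitely supported functions, i.e. elements of the real vector space
  \<open>'b \<Rightarrow>\<^sub>0 real\<close>; the chain spaces are the subspaces of chains supported on the admissible basis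
  elements.\<close>

definition basis_chain :: "'b \<Rightarrow> 'b \<Rightarrow>\<^sub>0 real" where
  "basis_chain b = Poly_Mapping.single b 1"

definition chains_on :: "'b set \<Rightarrow> ('b \<Rightarrow>\<^sub>0 real) set" where
  "chains_on B = {c. Poly_Mapping.keys c \<subseteq> B}"

definition lin_ext :: "('b \<Rightarrow> 'c::real_vector) \<Rightarrow> ('b \<Rightarrow>\<^sub>0 real) \<Rightarrow> 'c" where
  "lin_ext f c = (\<Sum>b\<in>Poly_Mapping.keys c. Poly_Mapping.lookup c b *\<^sub>R f b)"

definition linear_map :: "'a::real_vector set \<Rightarrow> 'b::real_vector set \<Rightarrow> ('a \<Rightarrow> 'b) \<Rightarrow> bool" where
  "linear_map V W f \<longleftrightarrow> f \<in> V \<rightarrow> W \<and>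
     (\<forall>x\<in>V. \<forall>y\<in>V. f (x + y) = f x + f y) \<and> (\<forall>r. \<forall>x\<in>V. f (r *\<^sub>R x) = r *\<^sub>R f x)"

definition drop_at :: "nat \<Rightarrow> 'b list \<Rightarrow> 'b list" where
  "drop_at i vs = take i vs @ drop (Suc i) vs"


section \<open>Simplicial complexes and simplicial chains\<close>

text \<open>This is \<^const>\<open>simplicial_complex\<close> without the finiteness condition. As there, a nonempty
  complex contains the empty set as its \<open>(-1)\<close>-simplex.\<close>

definition geometric_complex :: "'a::euclidean_space set set \<Rightarrow> bool" where
  "geometric_complex X \<longleftrightarrow>
     (\<forall>S\<in>X. \<exists>n. n simplex S) \<and>
     (\<forall>F S. S \<in> X \<and> F face_of S \<longrightarrow> F \<in> X) \<and>
     (\<forall>S S'. S \<in> X \<and> S' \<in> X \<longrightarrow> (S \<inter> S') face_of S)"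

lemma simplicial_complex_iff_geometric_complex:
  "simplicial_complex X \<longleftrightarrow> finite X \<and> geometric_complex X"
  by (simp add: simplicial_complex_def geometric_complex_def)

definition complex_vertices :: "'a set set \<Rightarrow> 'a set" where
  "complex_vertices X = {v. {v} \<in> X}"

text \<open>The \<open>k\<close>-simplices, written as the lists of their vertices in increasing order for \<open>r\<close>.\<close>

definition incr_simplices ::
    "'a rel \<Rightarrow> 'a::euclidean_space set set \<Rightarrow> nat \<Rightarrow> 'a list set" where
  "incr_simplices r X k =
     {vs. sorted_wrt (\<lambda>v w. (v, w) \<in> r \<and> v \<noteq> w) vs \<and>
          (\<exists>S\<in>X. int k simplex S \<and> set vs = {v. v extreme_point_of S})}"

abbreviation simp_chains ::
    "'a rel \<Rightarrow> 'a::euclidean_space set set \<Rightarrow> nat \<Rightarrow> ('a list \<Rightarrow>\<^sub>0 real) set" where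
  "simp_chains r X k \<equiv> chains_on (incr_simplices r X k)"

fun simp_boundary :: "nat \<Rightarrow> ('a list \<Rightarrow>\<^sub>0 real) \<Rightarrow> ('a list \<Rightarrow>\<^sub>0 real)" where
  "simp_boundary 0 c = 0"
| "simp_boundary (Suc k) c =
     lin_ext (\<lambda>vs. \<Sum>i\<le>Suc k. (-1) ^ i *\<^sub>R basis_chain (drop_at i vs)) c"

text \<open>The chain map of an \<^emph>\<open>order preserving\<close> vertex map; otherwise the image lists would have to
  be sorted, with signs.\<close>

definition simp_push :: "('a \<Rightarrow> 'b) \<Rightarrow> ('a list \<Rightarrow>\<^sub>0 real) \<Rightarrow> ('b list \<Rightarrow>\<^sub>0 real)" where
  "simp_push f =
     lin_ext (\<lambda>vs. if distinct (map f vs) then basis_chain (map f vs) else 0)"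

definition admissible_product_complex ::
    "'a::euclidean_space set set \<Rightarrow> ('a \<times> real) set set \<Rightarrow> bool" where
  "admissible_product_complex X K \<longleftrightarrow>
     geometric_complex K \<and>
     \<Union>K = \<Union>X \<times> {0..1} \<and>
     (\<forall>S\<in>X. \<exists>K'\<subseteq>K. geometric_complex K' \<and> \<Union>K' = S \<times> {0..1}) \<and>
     (\<forall>S\<in>X. S \<times> {0} \<in> K \<and> S \<times> {1} \<in> K)"

definition lipschitz_contraction ::
    "'a::metric_space set \<Rightarrow> 'a \<Rightarrow> ('a \<times> real \<Rightarrow> 'a) \<Rightarrow> bool" where
  "lipschitz_contraction M a \<Phi> \<longleftrightarrow>
     \<Phi> \<in> M \<times> {0..1} \<rightarrow> M \<and> (\<exists>C. C-lipschitz_on (M \<times> {0..1}) \<Phi>) \<and>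
     (\<forall>x\<in>M. \<Phi> (x, 1) = x \<and> \<Phi> (x, 0) = a)"


section \<open>Lipschitz singular chains\<close>

text \<open>A point of \<open>\<real>\<^sup>k\<close> is an element of \<open>nat \<Rightarrow>\<^sub>0 real\<close> with support in \<open>{1..k}\<close>. The library metric on
  this type is the \<open>\<ell>\<^sup>1\<close> metric, which by the lemma below gives the same
  Lipschitz maps as the Euclidean one.\<close>

definition std_vertex :: "nat \<Rightarrow> nat \<Rightarrow>\<^sub>0 real" where
  "std_vertex i = (if i = 0 then 0 else Poly_Mapping.single i 1)"

definition std_simplex :: "nat \<Rightarrow> (nat \<Rightarrow>\<^sub>0 real) set" where
  "std_simplex k = convex hull (std_vertex ` {..k})"

lemma dist_poly_mapping_bounds:
  fixes x y :: "nat \<Rightarrow>\<^sub>0 real"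
  assumes "Poly_Mapping.keys x \<subseteq> {1..k}" "Poly_Mapping.keys y \<subseteq> {1..k}"
  defines "e \<equiv> L2_set (\<lambda>i. Poly_Mapping.lookup x i - Poly_Mapping.lookup y i) {1..k}"
  shows "e \<le> dist x y" "dist x y \<le> sqrt k * e"
proof -
  have d: "dist x y = (\<Sum>i\<in>{1..k}. \<bar>Poly_Mapping.lookup x i - Poly_Mapping.lookup y i\<bar>)"
    unfolding dist_poly_mapping_def dist_real_def
    by (rule sum.mono_neutral_left) (use assms in \<open>auto simp: in_keys_iff\<close>)
  show "e \<le> dist x y" unfolding d e_def by (rule L2_set_le_sum_abs)
  show "dist x y \<le> sqrt k * e"
    using L2_set_mult_ineq[of "\<lambda>_. 1" "\<lambda>i. Poly_Mapping.lookup x i - Poly_Mapping.lookup y i" "{1..k}"]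
    unfolding d e_def by (simp add: L2_set_def)
qed

lemma lipschitz_iff_euclidean_lipschitz:
  fixes S :: "(nat \<Rightarrow>\<^sub>0 real) set" and T :: "(nat \<Rightarrow>\<^sub>0 real) \<Rightarrow> 'a::metric_space"
  assumes "\<And>x. x \<in> S \<Longrightarrow> Poly_Mapping.keys x \<subseteq> {1..k}"
  shows "(\<exists>C. C-lipschitz_on S T) \<longleftrightarrow>
    (\<exists>C\<ge>0. \<forall>x\<in>S. \<forall>y\<in>S. dist (T x) (T y) \<le>
        C * L2_set (\<lambda>i. Poly_Mapping.lookup x i - Poly_Mapping.lookup y i) {1..k})"
    (is "?A \<longleftrightarrow> ?B")
proof
  assume ?A
  then obtain C where C: "C \<ge> 0" "\<And>x y. x \<in> S \<Longrightarrow> y \<in> S \<Longrightarrow> dist (T x) (T y) \<le> C * dist x y"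
    by (auto simp: lipschitz_on_def)
  show ?B
  proof (intro exI[of _ "C * sqrt k"] conjI ballI)
    fix x y assume "x \<in> S" "y \<in> S"
    have "dist (T x) (T y) \<le> C * dist x y" using C(2)[OF \<open>x \<in> S\<close> \<open>y \<in> S\<close>] .
    also have "\<dots> \<le> C * (sqrt k * L2_set (\<lambda>i. Poly_Mapping.lookup x i - Poly_Mapping.lookup y i) {1..k})"
      by (rule mult_left_mono[OF dist_poly_mapping_bounds(2) C(1)])
        (rule assms[OF \<open>x \<in> S\<close>] assms[OF \<open>y \<in> S\<close>])+
    finally show "dist (T x) (T y) \<le> C * sqrt k *
        L2_set (\<lambda>i. Poly_Mapping.lookup x i - Poly_Mapping.lookup y i) {1..k}"
      by (simp only: mult.assoc)
  qed (use C in simp)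
next
  assume ?B
  then obtain C where C: "C \<ge> 0" "\<And>x y. x \<in> S \<Longrightarrow> y \<in> S \<Longrightarrow> dist (T x) (T y) \<le>
        C * L2_set (\<lambda>i. Poly_Mapping.lookup x i - Poly_Mapping.lookup y i) {1..k}"
    by auto
  have "C-lipschitz_on S T"
  proof (rule lipschitz_onI)
    fix x y assume "x \<in> S" "y \<in> S"
    have "dist (T x) (T y) \<le> C * L2_set (\<lambda>i. Poly_Mapping.lookup x i - Poly_Mapping.lookup y i) {1..k}"
      using C(2)[OF \<open>x \<in> S\<close> \<open>y \<in> S\<close>] .
    also have "\<dots> \<le> C * dist x y"
      by (rule mult_left_mono[OF dist_poly_mapping_bounds(1) C(1)])
        (rule assms[OF \<open>x \<in> S\<close>] assms[OF \<open>y \<in> S\<close>])+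
    finally show "dist (T x) (T y) \<le> C * dist x y" .
  qed (use C in simp)
  then show ?A ..
qed

text \<open>Functions on \<open>std_simplex k\<close> are made \<^const>\<open>extensional\<close>, so that two singular simplices are
  equal iff they agree on \<open>std_simplex k\<close>.\<close>

definition lip_sing_simplices ::
    "nat \<Rightarrow> 'a::metric_space set \<Rightarrow> ((nat \<Rightarrow>\<^sub>0 real) \<Rightarrow> 'a) set" where
  "lip_sing_simplices k M =
     {T. T \<in> std_simplex k \<rightarrow>\<^sub>E M \<and> (\<exists>C. C-lipschitz_on (std_simplex k) T)}"

abbreviation lip_sing_chains ::
    "nat \<Rightarrow> 'a::metric_space set \<Rightarrow> (((nat \<Rightarrow>\<^sub>0 real) \<Rightarrow> 'a) \<Rightarrow>\<^sub>0 real) set" where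
  "lip_sing_chains k M \<equiv> chains_on (lip_sing_simplices k M)"

text \<open>\<open>L[a\<^sub>0,\<dots>,a\<^sub>k]\<close> for a list of length \<open>k + 1\<close>.\<close>

definition affine_simplex :: "'a::real_vector list \<Rightarrow> (nat \<Rightarrow>\<^sub>0 real) \<Rightarrow> 'a" where
  "affine_simplex as = (\<lambda>x\<in>std_simplex (length as - 1).
     as ! 0 + (\<Sum>i=1..length as - 1. Poly_Mapping.lookup x i *\<^sub>R (as ! i - as ! 0)))"

definition affine_chain :: "('a::real_vector list \<Rightarrow>\<^sub>0 real) \<Rightarrow> (((nat \<Rightarrow>\<^sub>0 real) \<Rightarrow> 'a) \<Rightarrow>\<^sub>0 real)" where
  "affine_chain = lin_ext (\<lambda>vs. basis_chain (affine_simplex vs))"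

text \<open>The boundary of singular \<open>k\<close>-chains, for \<open>k \<ge> 1\<close>.\<close>

definition sing_boundary ::
    "nat \<Rightarrow> (((nat \<Rightarrow>\<^sub>0 real) \<Rightarrow> 'a) \<Rightarrow>\<^sub>0 real) \<Rightarrow> (((nat \<Rightarrow>\<^sub>0 real) \<Rightarrow> 'a) \<Rightarrow>\<^sub>0 real)" where
  "sing_boundary k =
     lin_ext (\<lambda>T. \<Sum>i\<le>k. (-1) ^ i *\<^sub>R basis_chain
       (compose (std_simplex (k - 1)) T (affine_simplex (drop_at i (map std_vertex [0..<Suc k])))))"

definition sing_push ::
    "nat \<Rightarrow> ('a \<Rightarrow> 'b) \<Rightarrow> (((nat \<Rightarrow>\<^sub>0 real) \<Rightarrow> 'a) \<Rightarrow>\<^sub>0 real) \<Rightarrow> (((nat \<Rightarrow>\<^sub>0 real) \<Rightarrow> 'b) \<Rightarrow>\<^sub>0 real)" where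
  "sing_push k f = lin_ext (\<lambda>T. basis_chain (compose (std_simplex k) f T))"


section \<open>Prism operators and cone operators\<close>

text \<open>At \<open>k = 0\<close> the term \<open>E (k - 1) (simp_boundary k c)\<close> is \<open>E 0 0 = 0\<close>.\<close>

definition prism_operator ::
    "'a rel \<Rightarrow> 'a::euclidean_space set set \<Rightarrow> ('a \<times> real) rel \<Rightarrow> ('a \<times> real) set set \<Rightarrow>
     (nat \<Rightarrow> ('a list \<Rightarrow>\<^sub>0 real) \<Rightarrow> (('a \<times> real) list \<Rightarrow>\<^sub>0 real)) \<Rightarrow> bool" where
  "prism_operator rX X rK K E \<longleftrightarrow>
     (\<forall>k. linear_map (simp_chains rX X k) (simp_chains rK K (Suc k)) (E k)) \<and>
     (\<forall>k. \<forall>c\<in>simp_chains rX X k.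
        simp_boundary (Suc k) (E k c) + E (k - 1) (simp_boundary k c) =
        simp_push (\<lambda>v. (v, 1)) c - simp_push (\<lambda>v. (v, 0)) c)"

definition CoS ::
    "('a \<times> real \<Rightarrow> 'a::euclidean_space) \<Rightarrow>
     (nat \<Rightarrow> ('a list \<Rightarrow>\<^sub>0 real) \<Rightarrow> (('a \<times> real) list \<Rightarrow>\<^sub>0 real)) \<Rightarrow>
     nat \<Rightarrow> ('a list \<Rightarrow>\<^sub>0 real) \<Rightarrow> (((nat \<Rightarrow>\<^sub>0 real) \<Rightarrow> 'a) \<Rightarrow>\<^sub>0 real)" where
  "CoS \<Phi> E k = lin_ext (\<lambda>vs. sing_push (Suc k) \<Phi> (affine_chain (E k (basis_chain vs))))"

text \<open>
  In positive degree the identity carries the degenerate simplex \<open>L[a,\<dots>,a]\<close> (\<open>k + 1\<close> entries), which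
  is nonzero in the space of all formal linear combinations of Lipschitz singular simplices. The
  shorter form with right-hand side \<open>L\<sigma>\<close> is the same identity read modulo constant simplices of
  positive dimension; taken literally it fails for \<open>CoS\<close> on every simplex of positive dimension,
  as \<open>\<Phi> \<circ> L[(v\<^sub>0,0),\<dots>,(v\<^sub>k,0)] = L[a,\<dots>,a]\<close>.
\<close>

definition singular_cone_operator ::
    "'a rel \<Rightarrow> 'a::euclidean_space set set \<Rightarrow> 'a \<Rightarrow>
     (nat \<Rightarrow> ('a list \<Rightarrow>\<^sub>0 real) \<Rightarrow> (((nat \<Rightarrow>\<^sub>0 real) \<Rightarrow> 'a) \<Rightarrow>\<^sub>0 real)) \<Rightarrow> bool" where
  "singular_cone_operator r X a Co \<longleftrightarrow>
     (\<forall>k. linear_map (simp_chains r X k) (lip_sing_chains (Suc k) (\<Union>X)) (Co k)) \<and>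
     (\<forall>k\<ge>1. \<forall>vs\<in>incr_simplices r X k.
        Co (k - 1) (simp_boundary k (basis_chain vs)) +
          sing_boundary (k + 1) (Co k (basis_chain vs)) =
        basis_chain (affine_simplex vs) - basis_chain (affine_simplex (replicate (k + 1) a))) \<and>
     (\<forall>v\<in>complex_vertices X.
        sing_boundary 1 (Co 0 (basis_chain [v])) =
        basis_chain (affine_simplex [v]) - basis_chain (affine_simplex [a]))"

end

theory Submission
  imports Defs
begin

text \<open>The affine simplices and the Lipschitz map \<open>\<Phi>\<close> induce chain maps, so applying both to
  \<open>\<partial>E + E\<partial> = (j\<^sub>1)\<^sub># - (j\<^sub>0)\<^sub>#\<close> turns its left-hand side into \<open>\<partial>\<^sup>S Co\<^sup>S + Co\<^sup>S \<partial>\<close>. On the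
  right-hand side, \<open>\<Phi>\<close> is the identity on the top of the prism and constant on its bottom.\<close>

section \<open>Linear extension\<close>

text \<open>Summing over any finite set that contains the support lets chains with different
  supports be handled over a common index set.\<close>

lemma lin_ext_eq_sum:
  assumes "finite A" "Poly_Mapping.keys c \<subseteq> A"
  shows "lin_ext f c = (\<Sum>b\<in>A. Poly_Mapping.lookup c b *\<^sub>R f b)"
  unfolding lin_ext_def
  by (rule sum.mono_neutral_left) (use assms in \<open>auto simp: in_keys_iff\<close>)

lemma lookup_scaleR_poly_mapping [simp]:
  "Poly_Mapping.lookup (r *\<^sub>R c) b = r * Poly_Mapping.lookup c b" for c :: "'b \<Rightarrow>\<^sub>0 real"
proof -
  \<comment> \<open>Scalar multiplication goes through the abstraction function, so its values can
    be read off only once the support is known to be finite.\<close>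
  have "{i. r *\<^sub>R Poly_Mapping.lookup c i \<noteq> 0} \<subseteq> Poly_Mapping.keys c"
    by (auto simp: in_keys_iff)
  then have "finite {i. r *\<^sub>R Poly_Mapping.lookup c i \<noteq> 0}"
    by (rule finite_subset) simp
  then show ?thesis by (simp add: scaleR_poly_mapping_def Abs_poly_mapping_inverse)
qed

lemma keys_scaleR_subset: "Poly_Mapping.keys (r *\<^sub>R c) \<subseteq> Poly_Mapping.keys c"
  for c :: "'b \<Rightarrow>\<^sub>0 real"
  by (auto simp: in_keys_iff)

lemma linear_lin_ext:
  fixes f :: "'b \<Rightarrow> 'c::real_vector"
  shows "linear (lin_ext f)"
proof (rule linearI)
  fix x y :: "'b \<Rightarrow>\<^sub>0 real" and r :: real
  let ?A = "Poly_Mapping.keys x \<union> Poly_Mapping.keys y"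
  have "Poly_Mapping.keys (x + y) \<subseteq> ?A" by (rule Poly_Mapping.keys_add)
  then show "lin_ext f (x + y) = lin_ext f x + lin_ext f y"
    by (simp add: lin_ext_eq_sum[of ?A] lookup_add scaleR_add_left sum.distrib)
  show "lin_ext f (r *\<^sub>R x) = r *\<^sub>R lin_ext f x"
    by (simp add: lin_ext_eq_sum[OF finite_keys keys_scaleR_subset[of r x]]
        lin_ext_def[of f x] scaleR_right.sum)
qed

lemmas lin_ext_add = linear_add[OF linear_lin_ext]
  and lin_ext_scaleR = linear_scale[OF linear_lin_ext]
  and lin_ext_sum = linear_sum[OF linear_lin_ext]

lemma lin_ext_basis_chain [simp]: "lin_ext f (basis_chain b) = f b"
  by (simp add: lin_ext_def basis_chain_def)

lemma lin_ext_cong: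
  "(\<And>b. b \<in> Poly_Mapping.keys c \<Longrightarrow> f b = g b) \<Longrightarrow> lin_ext f c = lin_ext g c"
  by (simp add: lin_ext_def)

text \<open>Linearity of the outer map lets it pass through the finite sum. Identities between
  composites of operators are thereby reduced to single basis elements via
  \<open>lin_ext_cong\<close>.\<close>

lemma lin_ext_lin_ext: "lin_ext g (lin_ext f c) = lin_ext (\<lambda>b. lin_ext g (f b)) c"
  by (simp add: lin_ext_def[of f] lin_ext_def[of "\<lambda>b. lin_ext g (f b)"] lin_ext_sum lin_ext_scaleR)

lemma basis_chain_in_chains_on: "b \<in> B \<Longrightarrow> basis_chain b \<in> chains_on B"
  by (simp add: chains_on_def basis_chain_def)

lemma subspace_chains_on: "subspace (chains_on B)"
  unfolding subspace_def chains_on_def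
  using Poly_Mapping.keys_add keys_scaleR_subset by fastforce

lemma lin_ext_in_subspace:
  assumes "subspace W" "c \<in> chains_on B" "\<And>b. b \<in> B \<Longrightarrow> f b \<in> W"
  shows "lin_ext f c \<in> W"
  unfolding lin_ext_def
  by (rule subspace_sum[OF assms(1)], rule subspace_scale[OF assms(1)])
    (use assms(2,3) in \<open>auto simp: chains_on_def\<close>)

lemma lin_ext_basis_chain_id: "lin_ext basis_chain c = c"
proof (rule poly_mapping_eqI)
  fix b
  show "Poly_Mapping.lookup (lin_ext basis_chain c) b = Poly_Mapping.lookup c b"
    by (simp add: lin_ext_def lookup_sum basis_chain_def lookup_single when_def sum.delta
        in_keys_iff if_distrib[of "\<lambda>z. _ * z"] cong: if_cong)
qed

text \<open>Here \<open>f\<close> is linear only on the subspace \<open>chains_on B\<close>, so the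
  rules for \<open>linear\<close> do not apply to it. It is taken through the finite basis expansion
  of \<open>c\<close> by induction, all partial sums staying in the subspace.\<close>

lemma linear_map_eq_lin_ext:
  assumes f: "linear_map (chains_on B) W f" and c: "c \<in> chains_on B"
  shows "f c = lin_ext (\<lambda>b. f (basis_chain b)) c"
proof -
  have add: "f (x + y) = f x + f y" if "x \<in> chains_on B" "y \<in> chains_on B" for x y
    using f that by (simp add: linear_map_def)
  have scale: "f (r *\<^sub>R x) = r *\<^sub>R f x" if "x \<in> chains_on B" for r x
    using f that by (simp add: linear_map_def)
  note V = subspace_chains_on[of B]
  have zero: "f 0 = 0"
    using scale[OF subspace_0[OF V], of 0] by simp
  have "f (\<Sum>b\<in>A. r b *\<^sub>R basis_chain b) = (\<Sum>b\<in>A. r b *\<^sub>R f (basis_chain b))"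
    if "finite A" "A \<subseteq> B" for A and r :: "_ \<Rightarrow> real"
    using that
  proof (induction A rule: finite_induct)
    case (insert b A)
    have "b \<in> B" "A \<subseteq> B" using insert.prems by auto
    moreover have "(\<Sum>b\<in>A. r b *\<^sub>R basis_chain b) \<in> chains_on B"
      using \<open>A \<subseteq> B\<close> by (intro subspace_sum[OF V] subspace_scale[OF V] basis_chain_in_chains_on) auto
    ultimately show ?case
      using insert by (simp add: add scale basis_chain_in_chains_on subspace_scale[OF V])
  qed (simp add: zero)
  from this[of "Poly_Mapping.keys c" "Poly_Mapping.lookup c"] c
  have "f (lin_ext basis_chain c) = lin_ext (\<lambda>b. f (basis_chain b)) c"
    by (simp add: lin_ext_def chains_on_def)
  then show ?thesis by (simp add: lin_ext_basis_chain_id)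
qed


section \<open>Affine simplices\<close>

lemma length_drop_at: "i < length vs \<Longrightarrow> length (drop_at i vs) = length vs - 1"
  by (simp add: drop_at_def)

lemma nth_drop_at:
  "i < length vs \<Longrightarrow> j < length vs - 1 \<Longrightarrow> drop_at i vs ! j = vs ! (if j < i then j else Suc j)"
  by (auto simp: drop_at_def nth_append min_def)

lemma std_vertex_in_std_simplex: "i \<le> k \<Longrightarrow> std_vertex i \<in> std_simplex k"
  unfolding std_simplex_def by (rule hull_inc) simp

lemma convex_std_simplex: "convex (std_simplex k)"
  by (simp add: std_simplex_def)

text \<open>The constant term \<open>as ! 0\<close> splits because \<open>u + v = 1\<close>, and
  convexity of the standard simplex keeps the combination inside the restricted domain.\<close>

lemma affine_simplex_convex_combination:
  assumes "x \<in> std_simplex (length as - 1)" "y \<in> std_simplex (length as - 1)"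
    and "0 \<le> u" "0 \<le> v" "u + v = 1"
  shows "affine_simplex as (u *\<^sub>R x + v *\<^sub>R y) = u *\<^sub>R affine_simplex as x + v *\<^sub>R affine_simplex as y"
proof -
  have "u *\<^sub>R x + v *\<^sub>R y \<in> std_simplex (length as - 1)"
    using assms convexD[OF convex_std_simplex] by blast
  moreover define g where
    "g z = (\<Sum>i=1..length as - 1. Poly_Mapping.lookup z i *\<^sub>R (as ! i - as ! 0))" for z
  have "g (u *\<^sub>R x + v *\<^sub>R y) = u *\<^sub>R g x + v *\<^sub>R g y"
    by (simp add: g_def lookup_add scaleR_add_left sum.distrib scaleR_right.sum)
  moreover have "as ! 0 + (u *\<^sub>R p + v *\<^sub>R q) = u *\<^sub>R (as ! 0 + p) + v *\<^sub>R (as ! 0 + q)" for p q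
  proof -
    have "u *\<^sub>R (as ! 0 + p) + v *\<^sub>R (as ! 0 + q) = (u + v) *\<^sub>R as ! 0 + (u *\<^sub>R p + v *\<^sub>R q)"
      by (simp only: scaleR_add_left scaleR_add_right add_ac)
    then show ?thesis using assms(5) by simp
  qed
  moreover have "affine_simplex as z = as ! 0 + g z" if "z \<in> std_simplex (length as - 1)" for z
    using that by (simp add: affine_simplex_def g_def)
  ultimately show ?thesis
    using assms(1,2) by simp
qed

lemma affine_simplex_std_vertex:
  assumes "i < length as"
  shows "affine_simplex as (std_vertex i) = as ! i"
proof -
  have "std_vertex i \<in> std_simplex (length as - 1)"
    using assms by (intro std_vertex_in_std_simplex) auto
  moreover have "(\<Sum>j=1..length as - 1. Poly_Mapping.lookup (std_vertex i) j *\<^sub>R (as ! j - as ! 0))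
      = as ! i - as ! 0"
  \<comment> \<open>\<open>std_vertex 0\<close> is the origin, so for \<open>i = 0\<close> every
    coordinate vanishes; otherwise only the coordinate \<open>i\<close> survives.\<close>
  proof (cases "i = 0")
    case False
    have "(\<Sum>j=1..length as - 1. Poly_Mapping.lookup (std_vertex i) j *\<^sub>R (as ! j - as ! 0))
        = (\<Sum>j=1..length as - 1. if j = i then as ! j - as ! 0 else 0)"
      using False by (intro sum.cong) (auto simp: std_vertex_def lookup_single when_def)
    then show ?thesis using False assms by auto
  qed (simp add: std_vertex_def)
  ultimately show ?thesis by (simp add: affine_simplex_def)
qed

lemma affine_simplex_in_convex_hull:
  assumes "as \<noteq> []" "x \<in> std_simplex (length as - 1)"
  shows "affine_simplex as x \<in> convex hull (set as)"
proof -
  \<comment> \<open>The points with the desired property form a convex set containing the vertices,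
    hence all of their hull.\<close>
  let ?D = "{x \<in> std_simplex (length as - 1). affine_simplex as x \<in> convex hull (set as)}"
  have "convex ?D"
  proof (rule convexI)
    fix x y and u v :: real
    assume "x \<in> ?D" "y \<in> ?D" "0 \<le> u" "0 \<le> v" "u + v = 1"
    then show "u *\<^sub>R x + v *\<^sub>R y \<in> ?D"
      using convexD[OF convex_std_simplex] convexD[OF convex_convex_hull[of "set as"]]
      by (simp add: affine_simplex_convex_combination)
  qed
  moreover have "std_vertex ` {..length as - 1} \<subseteq> ?D"
  proof clarsimp
    fix i assume i: "i \<le> length as - Suc 0"
    then have "i < length as" using assms(1) by (cases as) auto
    then show "std_vertex i \<in> std_simplex (length as - Suc 0) \<and>
        affine_simplex as (std_vertex i) \<in> convex hull set as"
      using i by (simp add: std_vertex_in_std_simplex affine_simplex_std_vertex hull_inc)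
  qed
  ultimately have "std_simplex (length as - 1) \<subseteq> ?D"
    unfolding std_simplex_def by (metis hull_minimal)
  then show ?thesis using assms(2) by auto
qed

text \<open>Both sides of the second claim respect convex combinations, so agreement at the vertices
  suffices. The first claim keeps the inner face map inside the domain on which
  \<open>affine_simplex vs\<close> has its affine formula.\<close>

lemma affine_simplex_face:
  assumes vs: "length vs = Suc (Suc k)" and i: "i \<le> Suc k"
  defines "qs \<equiv> map std_vertex [0..<Suc (Suc k)]"
  shows "affine_simplex (drop_at i qs) ` std_simplex k \<subseteq> std_simplex (Suc k)" (is ?maps)
    and "compose (std_simplex k) (affine_simplex vs) (affine_simplex (drop_at i qs))
       = affine_simplex (drop_at i vs)" (is ?face)
proof -
  let ?q = "drop_at i qs" and ?w = "drop_at i vs"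
  have lq: "length qs = Suc (Suc k)" by (simp add: qs_def)
  have len: "length ?q = Suc k" "length ?w = Suc k"
    using vs i lq by (simp_all add: length_drop_at)
  have "set ?q \<subseteq> set qs"
    by (auto simp: drop_at_def dest: in_set_takeD in_set_dropD)
  also have "\<dots> = std_vertex ` {..Suc k}"
    by (simp add: qs_def atLeast0LessThan lessThan_Suc_atMost del: upt_Suc)
  finally have "convex hull (set ?q) \<subseteq> std_simplex (Suc k)"
    unfolding std_simplex_def by (rule hull_mono)
  moreover have "affine_simplex ?q x \<in> convex hull (set ?q)" if "x \<in> std_simplex k" for x
    by (rule affine_simplex_in_convex_hull) (use that len in auto)
  ultimately have maps: "affine_simplex ?q x \<in> std_simplex (Suc k)" if "x \<in> std_simplex k" for x
    using that by blast
  then show ?maps by blast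
  let ?D = "{x \<in> std_simplex k. affine_simplex vs (affine_simplex ?q x) = affine_simplex ?w x}"
  have "convex ?D"
  proof (rule convexI)
    fix x y and u v :: real
    assume "x \<in> ?D" "y \<in> ?D" "0 \<le> u" "0 \<le> v" "u + v = 1"
    then show "u *\<^sub>R x + v *\<^sub>R y \<in> ?D"
      using convexD[OF convex_std_simplex] maps
      by (simp add: affine_simplex_convex_combination len vs)
  qed
  moreover have "std_vertex ` {..k} \<subseteq> ?D"
  proof clarsimp
    fix j assume j: "j \<le> k"
    \<comment> \<open>Deleting position \<open>i\<close> fixes the earlier indices and shifts the
      later ones by one, in \<open>qs\<close> and in \<open>vs\<close> alike.\<close>
    let ?m = "if j < i then j else Suc j"
    have "affine_simplex ?q (std_vertex j) = std_vertex ?m"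
      using j i lq len by (simp add: affine_simplex_std_vertex nth_drop_at) (simp add: qs_def del: upt_Suc)
    moreover have "affine_simplex vs (std_vertex ?m) = vs ! ?m"
      using j vs by (simp add: affine_simplex_std_vertex)
    moreover have "affine_simplex ?w (std_vertex j) = vs ! ?m"
      using j i vs len by (simp add: affine_simplex_std_vertex nth_drop_at)
    ultimately show "std_vertex j \<in> std_simplex k \<and>
        affine_simplex vs (affine_simplex ?q (std_vertex j)) = affine_simplex ?w (std_vertex j)"
      using j by (simp add: std_vertex_in_std_simplex)
  qed
  ultimately have "std_simplex k \<subseteq> ?D"
    unfolding std_simplex_def[of k] by (metis (no_types, lifting) hull_minimal std_simplex_def)
  \<comment> \<open>Both functions are extensional on the standard simplex, so agreement there is
    equality.\<close>
  then show ?face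
    by (intro extensionalityI[of _ "std_simplex k"])
      (use len in \<open>auto simp: compose_def affine_simplex_def\<close>)
qed

lemma lipschitz_affine_simplex:
  fixes as :: "'a::real_normed_vector list"
  shows "\<exists>C. C-lipschitz_on (std_simplex (length as - 1)) (affine_simplex as)"
proof
  let ?I = "{1..length as - 1}"
  \<comment> \<open>Each coordinate difference is at most the distance in the sum metric, so the
    lengths of the edges at \<open>as ! 0\<close> add up to a Lipschitz constant.\<close>
  let ?C = "\<Sum>i\<in>?I. norm (as ! i - as ! 0)"
  show "?C-lipschitz_on (std_simplex (length as - 1)) (affine_simplex as)"
  proof (rule lipschitz_onI)
    fix x y assume xy: "x \<in> std_simplex (length as - 1)" "y \<in> std_simplex (length as - 1)"
    let ?d = "\<lambda>i. Poly_Mapping.lookup x i - Poly_Mapping.lookup y i"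
    have le: "\<bar>?d i\<bar> \<le> dist x y" for i
    proof (cases "i \<in> Poly_Mapping.keys x \<union> Poly_Mapping.keys y")
      case True
      then show ?thesis
        unfolding dist_poly_mapping_def dist_real_def
        by (intro member_le_sum) auto
    qed (simp add: in_keys_iff)
    have "dist (affine_simplex as x) (affine_simplex as y)
        = norm (\<Sum>i\<in>?I. ?d i *\<^sub>R (as ! i - as ! 0))"
      using xy by (simp add: dist_norm affine_simplex_def scaleR_diff_left flip: sum_subtractf)
    also have "\<dots> \<le> (\<Sum>i\<in>?I. \<bar>?d i\<bar> * norm (as ! i - as ! 0))"
      by (rule order_trans[OF norm_sum]) simp
    also have "\<dots> \<le> (\<Sum>i\<in>?I. dist x y * norm (as ! i - as ! 0))"
      by (intro sum_mono mult_right_mono le) simp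
    finally show "dist (affine_simplex as x) (affine_simplex as y) \<le> ?C * dist x y"
      by (simp add: sum_distrib_left sum_distrib_right mult.commute)
  qed (simp add: sum_nonneg)
qed

text \<open>All vertices have the same height \<open>t\<close>, so the edge vectors vanish in the
  last component.\<close>

lemma affine_simplex_Pair:
  assumes "vs \<noteq> []" "x \<in> std_simplex (length vs - 1)"
  shows "affine_simplex (map (\<lambda>v. (v, t)) vs) x = (affine_simplex vs x, t)"
proof -
  let ?w = "map (\<lambda>v. (v, t)) vs"
  have "(\<Sum>i=1..length vs - 1. Poly_Mapping.lookup x i *\<^sub>R (?w ! i - ?w ! 0))
      = (\<Sum>i=1..length vs - 1. (Poly_Mapping.lookup x i *\<^sub>R (vs ! i - vs ! 0), 0))"
    using assms(1) by (intro sum.cong) auto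
  also have "\<dots> = (\<Sum>i=1..length vs - 1. Poly_Mapping.lookup x i *\<^sub>R (vs ! i - vs ! 0), 0)"
    by (intro prod_eqI) (simp_all add: fst_sum snd_sum)
  finally show ?thesis
    using assms by (simp add: affine_simplex_def)
qed

lemma affine_simplex_replicate:
  "affine_simplex (replicate (Suc k) a) = (\<lambda>x\<in>std_simplex k. a)"
proof -
  have "(\<Sum>i=1..k. Poly_Mapping.lookup x i *\<^sub>R (replicate (Suc k) a ! i - replicate (Suc k) a ! 0)) = 0"
    for x
    by (rule sum.neutral) (auto simp del: replicate_Suc)
  then show ?thesis
    by (simp add: affine_simplex_def del: replicate_Suc)
qed


section \<open>Increasing simplices\<close>

text \<open>The extreme points of the hull of an affinely independent set are exactly that set, so
  the list enumerates the affinely independent set spanning the simplex. Strictness of the ordering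
  rules out repetitions.\<close>

lemma incr_simplicesE:
  assumes "vs \<in> incr_simplices r X k"
  obtains "length vs = Suc k" "distinct vs" "convex hull (set vs) \<in> X" "\<not> affine_dependent (set vs)"
    "sorted_wrt (\<lambda>v w. (v, w) \<in> r \<and> v \<noteq> w) vs"
proof -
  obtain S where S: "S \<in> X" "int k simplex S" "set vs = {v. v extreme_point_of S}"
    and sorted: "sorted_wrt (\<lambda>v w. (v, w) \<in> r \<and> v \<noteq> w) vs"
    using assms by (auto simp: incr_simplices_def)
  obtain C where C: "\<not> affine_dependent C" "int (card C) = int k + 1" "S = convex hull C"
    using S(2) by (auto simp: simplex)
  have "set vs = C"
    using S(3) C extreme_point_of_convex_hull_affine_independent[OF C(1)] by auto
  moreover have "distinct vs"
    using sorted by (simp add: sorted_wrt_iff_nth_less distinct_conv_nth) (metis linorder_neqE_nat)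
  moreover from calculation have "length vs = Suc k"
    using C(2) by (simp flip: distinct_card)
  ultimately show ?thesis using that S(1) C sorted by auto
qed

lemma incr_simplicesI:
  assumes "length vs = Suc k" "convex hull (set vs) \<in> X" "\<not> affine_dependent (set vs)"
    "sorted_wrt (\<lambda>v w. (v, w) \<in> r \<and> v \<noteq> w) vs"
  shows "vs \<in> incr_simplices r X k"
proof -
  have "distinct vs"
    using assms(4) by (simp add: sorted_wrt_iff_nth_less distinct_conv_nth) (metis linorder_neqE_nat)
  then have "int k simplex (convex hull (set vs))"
    unfolding simplex using assms(1,3) by (intro exI[of _ "set vs"]) (simp add: distinct_card)
  moreover have "set vs = {v. v extreme_point_of (convex hull (set vs))}"
    using extreme_point_of_convex_hull_affine_independent[OF assms(3)] by auto
  ultimately show ?thesis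
    using assms(2,4) unfolding incr_simplices_def by blast
qed

text \<open>Any subset of an affinely independent vertex set spans a face, and a complex contains
  the faces of its simplices. Deleting an entry keeps the list increasing.\<close>

lemma drop_at_in_incr_simplices:
  assumes X: "geometric_complex X" and vs: "vs \<in> incr_simplices r X (Suc k)" and i: "i \<le> Suc k"
  shows "drop_at i vs \<in> incr_simplices r X k"
proof -
  from vs obtain *: "length vs = Suc (Suc k)" "convex hull (set vs) \<in> X" "\<not> affine_dependent (set vs)"
    "sorted_wrt (\<lambda>v w. (v, w) \<in> r \<and> v \<noteq> w) vs"
    by (rule incr_simplicesE)
  have sub: "set (drop_at i vs) \<subseteq> set vs"
    by (auto simp: drop_at_def dest: in_set_takeD in_set_dropD)
  have "vs = take i vs @ vs ! i # drop (Suc i) vs"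
    using *(1) i by (simp add: id_take_nth_drop)
  then have "sorted_wrt (\<lambda>v w. (v, w) \<in> r \<and> v \<noteq> w) (take i vs @ vs ! i # drop (Suc i) vs)"
    using *(4) by simp
  then have "sorted_wrt (\<lambda>v w. (v, w) \<in> r \<and> v \<noteq> w) (drop_at i vs)"
    by (auto simp: drop_at_def sorted_wrt_append)
  moreover have "convex hull (set (drop_at i vs)) face_of convex hull (set vs)"
    using face_of_convex_hull_affine_independent[OF *(3)] sub by blast
  then have "convex hull (set (drop_at i vs)) \<in> X"
    using X *(2) unfolding geometric_complex_def by blast
  moreover have "\<not> affine_dependent (set (drop_at i vs))"
    using *(3) sub affine_independent_subset by blast
  ultimately show ?thesis
    using *(1) i by (intro incr_simplicesI) (simp_all add: length_drop_at)
qed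

lemma singleton_in_incr_simplices:
  "v \<in> complex_vertices X \<Longrightarrow> [v] \<in> incr_simplices r X 0"
  by (rule incr_simplicesI) (simp_all add: complex_vertices_def)

lemma affine_simplex_in_complex:
  assumes "vs \<in> incr_simplices r X k" "x \<in> std_simplex k"
  shows "affine_simplex vs x \<in> \<Union>X"
proof -
  from assms(1) obtain "length vs = Suc k" "convex hull (set vs) \<in> X"
    by (rule incr_simplicesE)
  moreover from this have "affine_simplex vs x \<in> convex hull (set vs)"
    using assms(2) by (intro affine_simplex_in_convex_hull) auto
  ultimately show ?thesis by blast
qed

lemma simp_boundary_in_chains:
  assumes "geometric_complex X" "c \<in> simp_chains r X (Suc k)"
  shows "simp_boundary (Suc k) c \<in> simp_chains r X k"
  unfolding simp_boundary.simps
  by (rule lin_ext_in_subspace[OF subspace_chains_on assms(2)],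
      intro subspace_sum[OF subspace_chains_on] subspace_scale[OF subspace_chains_on]
        basis_chain_in_chains_on drop_at_in_incr_simplices[OF assms(1)]) auto


section \<open>The pushed affine chain map\<close>

lemma sing_push_affine_chain:
  "sing_push k f (affine_chain c)
    = lin_ext (\<lambda>vs. basis_chain (compose (std_simplex k) f (affine_simplex vs))) c"
  by (simp add: sing_push_def affine_chain_def lin_ext_lin_ext)

lemma linear_sing_push_affine_chain: "linear (\<lambda>c. sing_push k f (affine_chain c))"
  unfolding sing_push_affine_chain by (rule linear_lin_ext)

text \<open>Each face of an affine simplex is the affine simplex on the list with one vertex
  deleted, and composition with \<open>f\<close> is associative. Hence forming affine simplices and
  pushing them forward is a chain map.\<close>

lemma sing_boundary_sing_push_affine_chain:
  assumes "c \<in> simp_chains r K (Suc k)"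
  shows "sing_boundary (Suc k) (sing_push (Suc k) f (affine_chain c))
    = sing_push k f (affine_chain (simp_boundary (Suc k) c))"
  unfolding sing_push_affine_chain sing_boundary_def simp_boundary.simps lin_ext_lin_ext
    lin_ext_basis_chain lin_ext_sum lin_ext_scaleR
proof (intro lin_ext_cong sum.cong refl arg_cong[where f = "scaleR _"] arg_cong[where f = basis_chain])
  fix vs i assume "vs \<in> Poly_Mapping.keys c" and i: "i \<in> {..Suc k}"
  then have "vs \<in> incr_simplices r K (Suc k)" using assms by (auto simp: chains_on_def)
  then have len: "length vs = Suc (Suc k)" by (rule incr_simplicesE)
  let ?q = "affine_simplex (drop_at i (map std_vertex [0..<Suc (Suc k)]))"
  \<comment> \<open>Rebracketing is valid because the face map \<open>?q\<close> lands in the larger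
    standard simplex, to which the inner \<open>compose\<close> is restricted.\<close>
  have "compose (std_simplex k) (compose (std_simplex (Suc k)) f (affine_simplex vs)) ?q
      = compose (std_simplex k) f (compose (std_simplex k) (affine_simplex vs) ?q)"
    using affine_simplex_face(1)[OF len, of i] i by (auto simp: compose_def fun_eq_iff restrict_def)
  also have "\<dots> = compose (std_simplex k) f (affine_simplex (drop_at i vs))"
    using affine_simplex_face(2)[OF len, of i] i by simp
  finally show "compose (std_simplex (Suc k - 1)) (compose (std_simplex (Suc k)) f (affine_simplex vs)) ?q
      = compose (std_simplex k) f (affine_simplex (drop_at i vs))" by simp
qed

lemma sing_push_affine_chain_in_chains:
  assumes c: "c \<in> simp_chains r K k"
    and f: "f \<in> \<Union>K \<rightarrow> M" "C-lipschitz_on (\<Union>K) f"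
  shows "sing_push k f (affine_chain c) \<in> lip_sing_chains k M"
  unfolding sing_push_affine_chain
proof (intro lin_ext_in_subspace[OF subspace_chains_on c] basis_chain_in_chains_on)
  fix vs assume vs: "vs \<in> incr_simplices r K k"
  then have len: "length vs = Suc k" by (rule incr_simplicesE)
  have maps: "affine_simplex vs ` std_simplex k \<subseteq> \<Union>K"
    using affine_simplex_in_complex[OF vs] by blast
  obtain D where "D-lipschitz_on (std_simplex k) (affine_simplex vs)"
    using lipschitz_affine_simplex[of vs] len by auto
  \<comment> \<open>Lipschitz constants multiply under composition; \<open>maps\<close> places the
    image where \<open>f\<close> is Lipschitz.\<close>
  then have "(C * D)-lipschitz_on (std_simplex k) (f \<circ> affine_simplex vs)"
    using f(2) maps by (intro lipschitz_on_compose) (auto intro: lipschitz_on_subset)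
  then have "(C * D)-lipschitz_on (std_simplex k) (compose (std_simplex k) f (affine_simplex vs))"
    by (rule lipschitz_on_transform) (simp add: compose_def)
  then show "compose (std_simplex k) f (affine_simplex vs) \<in> lip_sing_simplices k M"
    using maps f(1) by (fastforce simp: lip_sing_simplices_def compose_def)
qed

text \<open>At constant height the pushed simplex only sees \<Phi>(\<cdot>,1), the identity, or
  \<Phi>(\<cdot>,0), the constant \<open>a\<close>. The bottom thus yields the constant simplex,
  which is a basis element in every degree.\<close>

lemma sing_push_lipschitz_contraction:
  assumes \<Phi>: "lipschitz_contraction (\<Union>X) a \<Phi>" and vs: "vs \<in> incr_simplices r X k"
  shows "sing_push k \<Phi> (affine_chain (simp_push (\<lambda>v. (v, 1)) (basis_chain vs)))
      = basis_chain (affine_simplex vs)"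
    and "sing_push k \<Phi> (affine_chain (simp_push (\<lambda>v. (v, 0)) (basis_chain vs)))
      = basis_chain (affine_simplex (replicate (Suc k) a))"
proof -
  from vs obtain len: "length vs = Suc k" and "distinct vs"
    by (rule incr_simplicesE)
  \<comment> \<open>The map \<open>\<lambda>v. (v, t)\<close> is injective, so the degenerate branch
    of \<open>simp_push\<close> does not occur.\<close>
  then have push: "simp_push (\<lambda>v. (v, t)) (basis_chain vs) = basis_chain (map (\<lambda>v. (v, t)) vs)"
    for t :: real
    by (simp add: simp_push_def distinct_map inj_on_def)
  have Pair: "affine_simplex (map (\<lambda>v. (v, t)) vs) x = (affine_simplex vs x, t)"
    if "x \<in> std_simplex k" for t :: real and x
    by (rule affine_simplex_Pair) (use that len in auto)
  have ends: "\<Phi> (affine_simplex vs x, 1) = affine_simplex vs x" "\<Phi> (affine_simplex vs x, 0) = a"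
    if "x \<in> std_simplex k" for x
    using \<Phi> affine_simplex_in_complex[OF vs that] by (auto simp: lipschitz_contraction_def)
  have "compose (std_simplex k) \<Phi> (affine_simplex (map (\<lambda>v. (v, 1)) vs)) = affine_simplex vs"
    by (rule extensionalityI[of _ "std_simplex k"])
      (use len in \<open>auto simp: compose_def Pair ends, auto simp: affine_simplex_def\<close>)
  then show "sing_push k \<Phi> (affine_chain (simp_push (\<lambda>v. (v, 1)) (basis_chain vs)))
      = basis_chain (affine_simplex vs)"
    by (simp add: sing_push_affine_chain push)
  have "compose (std_simplex k) \<Phi> (affine_simplex (map (\<lambda>v. (v, 0)) vs))
      = affine_simplex (replicate (Suc k) a)"
    unfolding affine_simplex_replicate
    by (auto simp: compose_def Pair ends restrict_def)
  then show "sing_push k \<Phi> (affine_chain (simp_push (\<lambda>v. (v, 0)) (basis_chain vs)))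
      = basis_chain (affine_simplex (replicate (Suc k) a))"
    by (simp add: sing_push_affine_chain push)
qed

section \<open>The cone identity for \<open>CoS\<close>\<close>

lemma CoS_eq:
  assumes "prism_operator rX X rK K E" "c \<in> simp_chains rX X k"
  shows "CoS \<Phi> E k c = sing_push (Suc k) \<Phi> (affine_chain (E k c))"
proof -
  have "linear_map (simp_chains rX X k) (simp_chains rK K (Suc k)) (E k)"
    using assms(1) by (simp add: prism_operator_def)
  \<comment> \<open>\<open>CoS\<close> is defined by its values on single simplices. Expanding
    \<open>E k c\<close> over the basis extends the formula to all chains, in particular to
    boundaries.\<close>
  from linear_map_eq_lin_ext[OF this assms(2)] show ?thesis
    by (simp add: CoS_def sing_push_affine_chain lin_ext_lin_ext)
qed

theorem theorem5p10:
  fixes X :: "'a::euclidean_space set set" and K :: "('a \<times> real) set set"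
    and rX :: "'a rel" and rK :: "('a \<times> real) rel"
    and \<Phi> :: "'a \<times> real \<Rightarrow> 'a" and a :: 'a
    and E :: "nat \<Rightarrow> ('a list \<Rightarrow>\<^sub>0 real) \<Rightarrow> (('a \<times> real) list \<Rightarrow>\<^sub>0 real)"
  assumes "geometric_complex X"
    and "a \<in> \<Union>X" and "lipschitz_contraction (\<Union>X) a \<Phi>"
    and "admissible_product_complex X K"
    and "linear_order_on (complex_vertices X) rX"
    and "linear_order_on (complex_vertices K) rK"
    and "\<And>v w. (v, w) \<in> rX \<Longrightarrow> ((v, 0), (w, 0)) \<in> rK \<and> ((v, 1), (w, 1)) \<in> rK"
    and "prism_operator rX X rK K E"
  shows "singular_cone_operator rX X a (CoS \<Phi> E)"
proof -
  note X = assms(1) and \<Phi> = assms(3) and E = assms(8)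
  note push_add = linear_add[OF linear_sing_push_affine_chain]
    and push_diff = linear_diff[OF linear_sing_push_affine_chain]
  have E_chains: "E k c \<in> simp_chains rK K (Suc k)" if "c \<in> simp_chains rX X k" for k c
    using E that by (auto simp: prism_operator_def linear_map_def)
  \<comment> \<open>The prism identity in degree 0 contains the term \<open>E 0 0\<close>, which has
    to vanish for the vertex case.\<close>
  have E_zero: "E 0 0 = 0"
  proof -
    have "linear_map (simp_chains rX X 0) (simp_chains rK K (Suc 0)) (E 0)"
      using E by (simp add: prism_operator_def)
    from linear_map_eq_lin_ext[OF this subspace_0[OF subspace_chains_on]]
    show ?thesis by (simp add: lin_ext_def)
  qed
  have K: "\<Union>K = \<Union>X \<times> {0..1}"
    using assms(4) by (simp add: admissible_product_complex_def)
  \<comment> \<open>The product complex fills the domain of the contraction exactly, so \<Phi> can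
    be composed with every affine simplex of \<open>K\<close>.\<close>
  obtain C where C: "C-lipschitz_on (\<Union>K) \<Phi>" and maps: "\<Phi> \<in> \<Union>K \<rightarrow> \<Union>X"
    using \<Phi> unfolding K by (auto simp: lipschitz_contraction_def)
  have "linear_map (simp_chains rX X k) (lip_sing_chains (Suc k) (\<Union>X)) (CoS \<Phi> E k)" for k
    unfolding linear_map_def
  proof (intro conjI funcsetI)
    fix c assume "c \<in> simp_chains rX X k"
    then show "CoS \<Phi> E k c \<in> lip_sing_chains (Suc k) (\<Union>X)"
      using sing_push_affine_chain_in_chains[OF E_chains maps C] by (simp add: CoS_eq[OF E])
  qed (simp_all add: CoS_def lin_ext_add lin_ext_scaleR)
  \<comment> \<open>The first term is written with \<open>E (k - 1)\<close> pushed forward in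
    dimension \<open>k\<close>, not with \<open>CoS\<close>, so that one identity covers both
    \<open>k = 0\<close> and positive degrees. In degree 0 the index \<open>k - 1\<close> is
    truncated to 0, and \<open>CoS \<Phi> E 0\<close> pushes forward in dimension 1.\<close>
  moreover have cone: "sing_push k \<Phi> (affine_chain (E (k - 1) (simp_boundary k (basis_chain vs)))) +
        sing_boundary (Suc k) (CoS \<Phi> E k (basis_chain vs)) =
      basis_chain (affine_simplex vs) - basis_chain (affine_simplex (replicate (Suc k) a))"
    if vs: "vs \<in> incr_simplices rX X k" for k vs
  proof -
    let ?c = "basis_chain vs"
    have c: "?c \<in> simp_chains rX X k"
      using vs by (rule basis_chain_in_chains_on)
    have "sing_boundary (Suc k) (CoS \<Phi> E k ?c)
        = sing_push k \<Phi> (affine_chain (simp_boundary (Suc k) (E k ?c)))"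
      by (simp only: CoS_eq[OF E c] sing_boundary_sing_push_affine_chain[OF E_chains[OF c]])
    then have "sing_push k \<Phi> (affine_chain (E (k - 1) (simp_boundary k ?c))) +
        sing_boundary (Suc k) (CoS \<Phi> E k ?c) =
        sing_push k \<Phi> (affine_chain
          (simp_boundary (Suc k) (E k ?c) + E (k - 1) (simp_boundary k ?c)))"
      by (simp only: push_add add.commute)
    also have "simp_boundary (Suc k) (E k ?c) + E (k - 1) (simp_boundary k ?c)
        = simp_push (\<lambda>v. (v, 1)) ?c - simp_push (\<lambda>v. (v, 0)) ?c"
      using E c unfolding prism_operator_def by blast
    finally show ?thesis
      by (simp only: push_diff sing_push_lipschitz_contraction[OF \<Phi> vs])
  qed
  have "CoS \<Phi> E (k - 1) (simp_boundary k (basis_chain vs)) +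
        sing_boundary (k + 1) (CoS \<Phi> E k (basis_chain vs)) =
      basis_chain (affine_simplex vs) - basis_chain (affine_simplex (replicate (k + 1) a))"
    if k: "k \<ge> 1" and vs: "vs \<in> incr_simplices rX X k" for k vs
  proof -
    \<comment> \<open>Now \<open>k = Suc (k - 1)\<close> holds, so the first term of
      \<open>cone\<close> is \<open>CoS\<close> in degree \<open>m\<close>, evaluated on the
      boundary chain.\<close>
    from k obtain m where m: "k = Suc m" by (cases k) auto
    have "simp_boundary (Suc m) (basis_chain vs) \<in> simp_chains rX X m"
      using vs by (intro simp_boundary_in_chains[OF X] basis_chain_in_chains_on) (simp add: m)
    from CoS_eq[OF E this, of \<Phi>] cone[OF vs] show ?thesis
      by (simp add: m del: simp_boundary.simps replicate_Suc)
  qed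
  moreover have "sing_boundary 1 (CoS \<Phi> E 0 (basis_chain [v])) =
      basis_chain (affine_simplex [v]) - basis_chain (affine_simplex [a])"
    if "v \<in> complex_vertices X" for v
    \<comment> \<open>For \<open>k = 0\<close> the simplicial boundary is 0, so the first term is
      the image of \<open>E 0 0 = 0\<close>, and the constant simplex has vertex list
      \<open>[a]\<close>.\<close>
    using cone[OF singleton_in_incr_simplices[OF that]]
    by (simp add: E_zero linear_0[OF linear_sing_push_affine_chain])
  ultimately show ?thesis
    unfolding singular_cone_operator_def by blast
qed

end
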